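(* Let $A\in\mathbb{R}^{m\times n}$ and let $M=M^\mathsf{T}\in\mathbb{R}^{m\times m}$ be nonsingular such that $AA^\mathsf{T}=M-N$. Let $\ell\ge1$ be an integer, $H=M^{-1}N$, and $C^{(\ell)}=\sum_{i=0}^{\ell-1}H^iM^{-1}$. Assume that $M$ is definite if $\ell$ is odd, and that $M+N$ is definite if $\ell$ is even. Then each of the CGNE and MRNE methods preconditioned by $\ell$ steps of the inner iterations, i.e., with preconditioning matrix $C^{(\ell)}$, determines the minimum-norm solution of $A\boldsymbol{x}=\boldsymbol{b}$ for all $\boldsymbol{b}\in\mathcal{R}(A)$ and for all $\boldsymbol{x}_0\in\mathcal{R}(A^\mathsf{T})$.
   Context: No rank or shape assumption is made on $A$. $\mathcal{R}(\cdot)$ denotes the range. The minimum-norm solution of $A\boldsymbol{x}=\boldsymbol{b}$ is the solution of smallest Euclidean norm. A symmetric matrix is definite if it is either positive definite or negative definite. $C^{(\ell)}$ is the matrix such that $C^{(\ell)}\boldsymbol{r}$ is the $\ell$th iterate of the stationary iteration $\boldsymbol{z}^{(j)}=H\boldsymbol{z}^{(j-1)}+M^{-1}\boldsymbol{r}$ with $\boldsymbol{z}^{(0)}=\boldsymbol{0}$. If $C^{(\ell)}$ is negative definite, the methods are understood with the sign changed, i.e., with $-C^{(\ell)}$ in place of $C^{(\ell)}$; write $C$ for the resulting positive definite matrix. The methods solve the normal equations of the second kind $AA^\mathsf{T}\boldsymbol{u}=\boldsymbol{b}$, $\boldsymbol{x}=A^\mathsf{T}\boldsymbol{u}$. Let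 $\boldsymbol{x}_0=A^\mathsf{T}\boldsymbol{u}_0$ be the initial iterate, $\boldsymbol{r}_0=\boldsymbol{b}-A\boldsymbol{x}_0$, and $\mathcal{K}_k=\mathrm{span}\{C\boldsymbol{r}_0,(CAA^\mathsf{T})C\boldsymbol{r}_0,\dots,(CAA^\mathsf{T})^{k-1}C\boldsymbol{r}_0\}$ (with $\mathcal{K}_0=\{\boldsymbol{0}\}$). Preconditioned CGNE is mathematically equivalent to preconditioned CG applied to $AA^\mathsf{T}\boldsymbol{u}=\boldsymbol{b}$: $\boldsymbol{x}_k=A^\mathsf{T}\boldsymbol{u}_k$, where $\boldsymbol{u}_k\in\boldsymbol{u}_0+\mathcal{K}_k$ minimizes $\|\boldsymbol{u}_k-\boldsymbol{u}_*\|_{AA^\mathsf{T}}=\|A^\mathsf{T}(\boldsymbol{u}_k-\boldsymbol{u}_* )\|_2$ with $\boldsymbol{u}_*$ any solution of $AA^\mathsf{T}\boldsymbol{u}=\boldsymbol{b}$. Preconditioned MRNE is mathematically equivalent to preconditioned MINRES applied to $AA^\mathsf{T}\boldsymbol{u}=\boldsymbol{b}$: $\boldsymbol{x}_k=A^\mathsf{T}\boldsymbol{u}_k$, where $\boldsymbol{u}_k\in\boldsymbol{u}_0+\mathcal{K}_k$ minimizes $\|C^{\frac12}(\boldsymbol{b}-AA^\mathsf{T}\boldsymbol{u}_k)\|_2$. "Determines the minimum-norm solution" means: in exact arithmetic, there is some $k\ge0$ such that the iterate $\boldsymbol{x}_k$ is well defined and equals the minimum-norm solution of $A\boldsymbol{x}=\boldsymbol{b}$.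 *)

theory Defs
  imports "HOL-Analysis.Analysis"
begin

definition positive_definite :: "real^'m^'m \<Rightarrow> bool" where
  "positive_definite P \<longleftrightarrow> transpose P = P \<and> (\<forall>v. v \<noteq> 0 \<longrightarrow> v \<bullet> (P *v v) > 0)"

definition negative_definite :: "real^'m^'m \<Rightarrow> bool" where
  "negative_definite P \<longleftrightarrow> transpose P = P \<and> (\<forall>v. v \<noteq> 0 \<longrightarrow> v \<bullet> (P *v v) < 0)"

definition definite :: "real^'m^'m \<Rightarrow> bool" where
  "definite P \<longleftrightarrow> positive_definite P \<or> negative_definite P"

(* The principal square root; only meant for positive definite P. *)
definition matrix_sqrt :: "real^'m^'m \<Rightarrow> real^'m^'m" where
  "matrix_sqrt P = (THE S. positive_definite S \<and> S ** S = P)"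

(* The operation ^ on square matrices would act entrywise, hence a separate power. *)
primrec matrix_power :: "real^'m^'m \<Rightarrow> nat \<Rightarrow> real^'m^'m" where
  "matrix_power P 0 = mat 1"
| "matrix_power P (Suc i) = P ** matrix_power P i"

definition inner_prec :: "real^'m^'m \<Rightarrow> real^'m^'m \<Rightarrow> nat \<Rightarrow> real^'m^'m" where
  "inner_prec M N l = (\<Sum>i<l. matrix_power (matrix_inv M ** N) i ** matrix_inv M)"

primrec inner_iterate ::
  "real^'m^'m \<Rightarrow> real^'m^'m \<Rightarrow> real^'m \<Rightarrow> nat \<Rightarrow> real^'m" where
  "inner_iterate M N r 0 = 0"
| "inner_iterate M N r (Suc j) =
     (matrix_inv M ** N) *v inner_iterate M N r j + matrix_inv M *v r"

lemma matrix_mult_sum_right: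
  fixes P :: "real^'m^'m"
  shows "P ** (\<Sum>i\<in>I. F i) = (\<Sum>i\<in>I. P ** F i)"
  by (induction I rule: infinite_finite_induct) (simp_all add: matrix_add_ldistrib)

(* So inner_prec M N l, applied to r, performs l steps of z := M^{-1} N z + M^{-1} r from z = 0. *)
lemma inner_prec_eq_inner_iterate: "inner_prec M N l *v r = inner_iterate M N r l"
proof (induction l)
  case 0
  show ?case by (simp add: inner_prec_def)
next
  case (Suc l)
  have "inner_prec M N (Suc l) = (matrix_inv M ** N) ** inner_prec M N l + matrix_inv M"
    unfolding inner_prec_def sum.lessThan_Suc_shift
    by (simp add: matrix_mul_assoc add.commute
        matrix_mult_sum_right)
  then show ?case
    using Suc by (simp add: matrix_vector_mult_add_rdistrib matrix_vector_mul_assoc[symmetric])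
qed

definition signed_prec :: "real^'m^'m \<Rightarrow> real^'m^'m" where
  "signed_prec P = (if negative_definite P then - P else P)"

definition krylov :: "real^'n^'m \<Rightarrow> real^'m^'m \<Rightarrow> real^'m \<Rightarrow> nat \<Rightarrow> (real^'m) set" where
  "krylov A C r k =
     span ((\<lambda>i. matrix_power (C ** A ** transpose A) i *v (C *v r)) ` {..<k})"

(* The set of all vectors that qualify as the k-th iterate x_k with initial iterate x0: all
   admissible u0, all solutions us of the normal equations and all minimizers u are taken
   into account.  So x_k is well defined iff this set is a singleton.  Both methods are
   only understood for a positive definite preconditioner C. *)
definition cgne_iterates ::
  "real^'n^'m \<Rightarrow> real^'m^'m \<Rightarrow> real^'m \<Rightarrow> real^'n \<Rightarrow> nat \<Rightarrow> (real^'n) set" where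
  "cgne_iterates A C b x0 k =
     {transpose A *v u | u u0 us.
        positive_definite C \<and>
        transpose A *v u0 = x0 \<and>
        (A ** transpose A) *v us = b \<and>
        is_arg_min (\<lambda>v. norm (transpose A *v (v - us)))
          (\<lambda>v. v \<in> (+) u0 ` krylov A C (b - A *v x0) k) u}"

definition mrne_iterates ::
  "real^'n^'m \<Rightarrow> real^'m^'m \<Rightarrow> real^'m \<Rightarrow> real^'n \<Rightarrow> nat \<Rightarrow> (real^'n) set" where
  "mrne_iterates A C b x0 k =
     {transpose A *v u | u u0.
        positive_definite C \<and>
        transpose A *v u0 = x0 \<and>
        is_arg_min (\<lambda>v. norm (matrix_sqrt C *v (b - (A ** transpose A) *v v)))
          (\<lambda>v. v \<in> (+) u0 ` krylov A C (b - A *v x0) k) u}"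

definition is_min_norm_solution :: "real^'n^'m \<Rightarrow> real^'m \<Rightarrow> real^'n \<Rightarrow> bool" where
  "is_min_norm_solution A b x \<longleftrightarrow> is_arg_min norm (\<lambda>y. A *v y = b) x"

definition determines_min_norm_solution ::
  "real^'n^'m \<Rightarrow> real^'m \<Rightarrow> (nat \<Rightarrow> (real^'n) set) \<Rightarrow> bool" where
  "determines_min_norm_solution A b X \<longleftrightarrow> (\<exists>k x. X k = {x} \<and> is_min_norm_solution A b x)"

end

theory Submission
  imports Defs
begin

text \<open>
  Put \<open>H = M\<^sup>-\<^sup>1 N\<close> and let \<open>C_l\<close> be the \<open>l\<close>-step preconditioner.  It is symmetric and satisfies
  \<open>C_(l+2) = (I + H) M\<^sup>-\<^sup>1 + H C_l H\<^sup>T\<close>.  For even \<open>l\<close> definiteness follows by induction from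
  \<open>(I + H) M\<^sup>-\<^sup>1 = M\<^sup>-\<^sup>1 (M + N) M\<^sup>-\<^sup>1\<close>; for odd \<open>l\<close> the recursion gives inductively that
  \<open>2 C_l - M\<^sup>-\<^sup>1\<close> is positive semidefinite, the step being completed by the square
  \<open>(I + H) M\<^sup>-\<^sup>1 (I + H)\<^sup>T\<close>.

  Let \<open>C\<close> be positive definite and \<open>G = A A\<^sup>T\<close>.  Since \<open>r\<^sub>0\<close> lies in the range of \<open>G\<close>, the
  Krylov spaces lie in the range of \<open>C G\<close>, which meets the kernel of \<open>C G\<close> trivially.  So
  \<open>C G\<close> is a bijection of the final Krylov space onto itself, and this space contains a solution
  of \<open>G z = r\<^sub>0\<close>.  Both objectives therefore attain the value \<open>0\<close>, which forces
  \<open>A A\<^sup>T u = b\<close>; then \<open>A\<^sup>T u\<close> is the minimum-norm solution.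
\<close>

text \<open>As a simp rule this would turn \<open>transpose P *v v\<close> into
  \<open>v v* P\<close>, while the statements below are phrased with \<open>*v\<close>.\<close>

declare transpose_matrix_vector [simp del]

section \<open>Definiteness\<close>

lemma matrix_add_rdistrib: "(P + Q) ** R = P ** R + (Q :: real^'n^'m) ** (R :: real^'k^'n)"
  by (simp add: matrix_matrix_mult_def vec_eq_iff sum.distrib distrib_right)

lemma matrix_vector_mult_uminus: "(- P) *v v = - (P *v (v :: real^'n))"
  by (simp add: matrix_vector_mult_def vec_eq_iff sum_negf)

lemma matrix_mult_uminus: "(- P) ** (- Q) = (P :: real^'n^'m) ** (Q :: real^'k^'n)"
  by (simp add: matrix_matrix_mult_def vec_eq_iff)

lemma transpose_uminus: "transpose (- P) = - transpose (P :: real^'n^'m)"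
  by (simp add: transpose_def vec_eq_iff)

lemma transpose_add: "transpose (P + Q) = transpose P + transpose (Q :: real^'n^'m)"
  by (simp add: transpose_def vec_eq_iff)

lemma transpose_diff: "transpose (P - Q) = transpose P - transpose (Q :: real^'n^'m)"
  by (simp add: transpose_def vec_eq_iff)

lemma inner_matrix_vector: "u \<bullet> (P *v v) = (transpose P *v u) \<bullet> (v :: real^'n)"
  by (simp add: transpose_matrix_vector dot_lmul_matrix)

lemma negative_definite_iff_uminus: "negative_definite P \<longleftrightarrow> positive_definite (- P)"
  by (auto simp: negative_definite_def positive_definite_def matrix_vector_mult_uminus
      transpose_uminus)

lemma positive_definite_nonneg: "positive_definite P \<Longrightarrow> v \<bullet> (P *v v) \<ge> 0"
  by (cases "v = 0") (auto simp: positive_definite_def less_imp_le)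

lemma positive_definite_mult_eq_0_iff: "positive_definite P \<Longrightarrow> P *v v = 0 \<longleftrightarrow> v = 0"
  by (force simp: positive_definite_def)

lemma positive_definite_signed_prec:
  assumes "definite P"
  shows "positive_definite (signed_prec P)"
  using assms by (auto simp: definite_def signed_prec_def negative_definite_iff_uminus)

section \<open>The inner-iteration preconditioner\<close>

lemma matrix_inv_mult:
  assumes "invertible (M :: real^'m^'m)"
  shows "matrix_inv M ** M = mat 1" "M ** matrix_inv M = mat 1"
  using someI_ex[OF assms[unfolded invertible_def]] by (auto simp: matrix_inv_def)

lemma transpose_matrix_inv:
  assumes "invertible (M :: real^'m^'m)" "transpose M = M"
  shows "transpose (matrix_inv M) = matrix_inv M"
proof -
  have "transpose (matrix_inv M) ** M = mat 1"
    by (metis assms matrix_inv_mult(2) matrix_transpose_mul transpose_mat)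
  then show ?thesis
    by (metis assms(1) matrix_inv_mult(2) matrix_mul_assoc matrix_mul_lid matrix_mul_rid)
qed

lemma matrix_inv_uminus:
  assumes "invertible (M :: real^'m^'m)"
  shows "matrix_inv (- M) = - matrix_inv M"
proof -
  have left: "(- matrix_inv M) ** (- M) = mat 1"
    by (simp add: matrix_mult_uminus matrix_inv_mult assms)
  moreover have "(- M) ** (- matrix_inv M) = mat 1"
    by (simp add: matrix_mult_uminus matrix_inv_mult assms)
  ultimately have "invertible (- M)" unfolding invertible_def by blast
  from matrix_inv_mult(2)[OF this] show ?thesis
    by (metis left matrix_mul_assoc matrix_mul_lid matrix_mul_rid)
qed

text \<open>The two signs cancel in \<open>matrix_inv M ** N\<close>, so only the last factor
  \<open>matrix_inv M\<close> of each summand changes sign. This reduces negative definite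
  splittings to positive definite ones.\<close>

lemma inner_prec_uminus:
  assumes "invertible (M :: real^'m^'m)"
  shows "inner_prec (- M) (- N) l = - inner_prec M N l"
proof -
  have "P ** (- Q) = - (P ** Q)" for P Q :: "real^'m^'m"
    by (simp add: matrix_matrix_mult_def vec_eq_iff sum_negf)
  then show ?thesis
    unfolding inner_prec_def matrix_inv_uminus[OF assms] matrix_mult_uminus
    by (simp add: sum_negf)
qed

lemma inner_prec_0 [simp]: "inner_prec M N 0 = 0"
  by (simp add: inner_prec_def)

lemma inner_prec_Suc:
  "inner_prec M N (Suc l) = matrix_inv M + matrix_inv M ** N ** inner_prec M N l"
  unfolding inner_prec_def sum.lessThan_Suc_shift
  by (simp add: matrix_mul_assoc matrix_mult_sum_right)

text \<open>With \<open>H = M^-1 N\<close>, both sides are the sum of \<open>H^(i+1) M^-1\<close>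
  over \<open>i < l\<close>. For symmetric \<open>M\<close> and \<open>N\<close> this reads
  \<open>C H^T = H C\<close>, which yields both the symmetry of \<open>C\<close> and the congruence
  \<open>H C H^T\<close> below.\<close>

lemma inner_prec_commute:
  "inner_prec M N l ** (N ** matrix_inv M) = (matrix_inv M ** N) ** inner_prec M N l"
proof (induction l)
  case (Suc l)
  have "inner_prec M N (Suc l) ** (N ** matrix_inv M) =
      (matrix_inv M ** N) ** (matrix_inv M + inner_prec M N l ** (N ** matrix_inv M))"
    by (simp add: inner_prec_Suc matrix_add_rdistrib matrix_add_ldistrib matrix_mul_assoc)
  also have "\<dots> = (matrix_inv M ** N) ** inner_prec M N (Suc l)"
    by (simp only: Suc inner_prec_Suc)
  finally show ?case .
qed simp

lemma transpose_inner_prec: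
  assumes "invertible M" "transpose M = M" "transpose N = N"
  shows "transpose (inner_prec M N l) = inner_prec M N l"
proof (induction l)
  case 0
  show ?case by (simp add: transpose_def vec_eq_iff)
next
  case (Suc l)
  then show ?case
    using inner_prec_commute[of M N l]
    by (simp add: inner_prec_Suc transpose_add matrix_transpose_mul assms transpose_matrix_inv)
qed

text \<open>Two steps of the recursion produce \<open>H (H C)\<close>; moving one factor
  \<open>H\<close> across \<open>C\<close> gives \<open>H C (N M^-1)\<close>, for symmetric
  \<open>M\<close> and \<open>N\<close> a congruence, which preserves semidefiniteness.\<close>

lemma inner_prec_Suc_Suc:
  "inner_prec M N (Suc (Suc l)) = matrix_inv M + matrix_inv M ** N ** matrix_inv M +
     matrix_inv M ** N ** inner_prec M N l ** (N ** matrix_inv M)"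
proof -
  have "matrix_inv M ** N ** inner_prec M N l ** (N ** matrix_inv M) =
      matrix_inv M ** N ** (matrix_inv M ** N ** inner_prec M N l)"
    by (simp only: matrix_mul_assoc[of "matrix_inv M ** N", symmetric] inner_prec_commute)
  then show ?thesis
    by (simp add: inner_prec_Suc[of M N "Suc l"] inner_prec_Suc[of M N l] matrix_add_ldistrib)
qed

text \<open>Since \<open>w v\<close> is \<open>H^T v\<close>, the congruence term becomes the form
  of the shorter preconditioner at \<open>w v\<close>, ready for induction in steps of two.\<close>

lemma inner_prec_Suc_Suc_quadratic_form:
  assumes "invertible M" "transpose M = M" "transpose N = N"
  defines "w v \<equiv> N *v (matrix_inv M *v v)"
  shows "v \<bullet> (inner_prec M N (Suc (Suc l)) *v v) =
    v \<bullet> (matrix_inv M *v v) + v \<bullet> (matrix_inv M *v w v) + w v \<bullet> (inner_prec M N l *v w v)"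
proof -
  have "transpose (matrix_inv M ** N) *v v = w v"
    by (simp add: matrix_transpose_mul assms transpose_matrix_inv matrix_vector_mul_assoc)
  then have "v \<bullet> ((matrix_inv M ** N) *v x) = w v \<bullet> x" for x
    using inner_matrix_vector[of v "matrix_inv M ** N" x] by simp
  then have "v \<bullet> (matrix_inv M *v (N *v x)) = w v \<bullet> x" for x
    by (simp add: matrix_vector_mul_assoc)
  then show ?thesis
    by (simp add: inner_prec_Suc_Suc matrix_vector_mult_add_rdistrib inner_add_right w_def
        flip: matrix_vector_mul_assoc)
qed

section \<open>Positive definiteness for odd and for even step counts\<close>

lemma positive_definite_inner_prec_odd:
  assumes "invertible M" "transpose N = N" "positive_definite M" "odd l"
  shows "positive_definite (inner_prec M N l)"
proof -
  have sym: "transpose M = M" using assms(3) by (simp add: positive_definite_def)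
  let ?P = "matrix_inv M"
  have symP: "transpose ?P = ?P" using assms(1) sym by (rule transpose_matrix_inv)
  have cancel: "M *v (?P *v v) = v" for v
    by (simp add: matrix_vector_mul_assoc matrix_inv_mult assms(1))
  have P_pos: "v \<bullet> (?P *v v) > 0" if "v \<noteq> 0" for v
  proof -
    have "?P *v v \<noteq> 0" using cancel[of v] that by auto
    then have "(?P *v v) \<bullet> (M *v (?P *v v)) > 0"
      using assms(3) by (simp add: positive_definite_def)
    then show ?thesis by (simp add: cancel inner_commute)
  qed
  have P_nonneg: "v \<bullet> (?P *v v) \<ge> 0" for v
    using P_pos[of v] by (cases "v = 0") auto
  \<comment> \<open>Positivity of the form alone would not control the cross term
    \<open>v \<bullet> (?P *v w)\<close>. This stronger bound supplies the summand
    \<open>w \<bullet> (?P *v w)\<close> that completes the square at \<open>v + w\<close>, and one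
    copy of \<open>v \<bullet> (?P *v v)\<close> is left over.\<close>
  have bound: "2 * (v \<bullet> (inner_prec M N (Suc (2 * p)) *v v)) \<ge> v \<bullet> (?P *v v)" for p v
  proof (induction p arbitrary: v)
    case 0
    show ?case using P_nonneg[of v] by (simp add: inner_prec_Suc)
  next
    case (Suc p)
    define w where "w = N *v (?P *v v)"
    have "w \<bullet> (?P *v v) = v \<bullet> (?P *v w)"
      using inner_matrix_vector[of v ?P w] by (simp add: symP inner_commute)
    then have "0 \<le> v \<bullet> (?P *v v) + 2 * (v \<bullet> (?P *v w)) + w \<bullet> (?P *v w)"
      using P_nonneg[of "v + w"]
      by (simp add: matrix_vector_right_distrib inner_add_left inner_add_right)
    then show ?case
      using Suc.IH[of w] inner_prec_Suc_Suc_quadratic_form[OF assms(1) sym assms(2), of v "Suc (2 * p)"]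
      by (simp add: w_def)
  qed
  obtain p where "l = Suc (2 * p)" using assms(4) by (auto elim: oddE)
  then have "v \<bullet> (inner_prec M N l *v v) > 0" if "v \<noteq> 0" for v
    using bound[of v p] P_pos[OF that] by simp
  then show ?thesis
    by (simp add: positive_definite_def transpose_inner_prec assms sym)
qed

lemma positive_definite_inner_prec_even:
  assumes "invertible M" "transpose M = M" "transpose N = N" "positive_definite (M + N)"
    "even l" "l \<noteq> 0"
  shows "positive_definite (inner_prec M N l)"
proof -
  let ?P = "matrix_inv M"
  have cancel: "M *v (?P *v v) = v" for v
    by (simp add: matrix_vector_mul_assoc matrix_inv_mult assms(1))
  \<comment> \<open>By \<open>?P = ?P ** M ** ?P\<close>, this sum is the quadratic form of
    \<open>M + N\<close> at \<open>?P *v v\<close>.\<close>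
  have pos: "v \<bullet> (?P *v v) + v \<bullet> (?P *v (N *v (?P *v v))) > 0" if "v \<noteq> 0" for v
  proof -
    have "?P *v v \<noteq> 0" using cancel[of v] that by auto
    then have "(?P *v v) \<bullet> ((M + N) *v (?P *v v)) > 0"
      using assms(4) by (simp add: positive_definite_def)
    moreover have "v \<bullet> (?P *v (N *v (?P *v v))) = (?P *v v) \<bullet> (N *v (?P *v v))"
      using inner_matrix_vector[of v ?P] transpose_matrix_inv[OF assms(1,2)] by simp
    ultimately show ?thesis
      by (simp add: matrix_vector_mult_add_rdistrib inner_add_right cancel
          inner_commute[of "?P *v v" v])
  qed
  \<comment> \<open>The induction starts from the zero matrix, so it gives only semidefiniteness;
    strictness comes from \<open>pos\<close> in the last two steps, which exist because
    \<open>l \<noteq> 0\<close>.\<close>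
  have nonneg: "v \<bullet> (inner_prec M N (2 * p) *v v) \<ge> 0" for p v
  proof (induction p arbitrary: v)
    case (Suc p)
    then show ?case
      using inner_prec_Suc_Suc_quadratic_form[OF assms(1-3), of v "2 * p"] pos[of v]
        Suc.IH[of "N *v (?P *v v)"]
      by (cases "v = 0") auto
  qed simp
  obtain q where "l = 2 * q" using assms(5) by blast
  then obtain p where "l = Suc (Suc (2 * p))" using assms(6) by (cases q) auto
  then have "v \<bullet> (inner_prec M N l *v v) > 0" if "v \<noteq> 0" for v
    using inner_prec_Suc_Suc_quadratic_form[OF assms(1-3), of v "2 * p"] pos[OF that]
      nonneg[of "N *v (?P *v v)" p]
    by simp
  then show ?thesis
    by (simp add: positive_definite_def transpose_inner_prec assms)
qed

text \<open>If the relevant matrix is negative definite, the positive definite case is applied to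
  \<open>- M\<close> and \<open>- N\<close>, whose preconditioner is the negative of the original
  one.\<close>

lemma definite_inner_prec:
  assumes "invertible M" "transpose M = M" "transpose N = N" "l \<ge> 1"
    and "odd l \<Longrightarrow> definite M" "even l \<Longrightarrow> definite (M + N)"
  shows "definite (inner_prec M N l)"
proof -
  have pos: "positive_definite (inner_prec M' N' l)"
    if "invertible M'" "transpose M' = M'" "transpose N' = N'"
      "odd l \<Longrightarrow> positive_definite M'" "even l \<Longrightarrow> positive_definite (M' + N')"
    for M' N' :: "real^'m^'m"
    using that assms(4) positive_definite_inner_prec_odd[of M' N' l]
      positive_definite_inner_prec_even[of M' N' l]
    by (cases "even l") auto
  have "(- M) ** (- matrix_inv M) = mat 1" "(- matrix_inv M) ** (- M) = mat 1"
    by (simp_all add: matrix_mult_uminus matrix_inv_mult assms(1))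
  then have inv: "invertible (- M)" unfolding invertible_def by blast
  have sum: "- M + - N = - (M + N)" by simp
  consider "odd l \<longrightarrow> positive_definite M" "even l \<longrightarrow> positive_definite (M + N)"
    | "odd l \<longrightarrow> positive_definite (- M)" "even l \<longrightarrow> positive_definite (- M + - N)"
    using assms(5,6) unfolding definite_def negative_definite_iff_uminus sum
    by (cases "even l") (simp_all, blast+)
  then show ?thesis
  proof cases
    case 1
    then have "positive_definite (inner_prec M N l)" using pos[OF assms(1-3)] by blast
    then show ?thesis by (simp add: definite_def)
  next
    case 2
    have "transpose (- M) = - M" "transpose (- N) = - N"
      by (simp_all only: transpose_uminus assms)
    then have "positive_definite (inner_prec (- M) (- N) l)" using pos[OF inv] 2 by blast
    then show ?thesis
      by (simp only: definite_def negative_definite_iff_uminus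
          inner_prec_uminus[OF assms(1)] simp_thms)
  qed
qed

section \<open>The principal square root\<close>

text \<open>The diagonal entries of \<open>D^T P D\<close> are the values of the form of
  \<open>P\<close> at the columns of \<open>D\<close>. For positive definite \<open>P\<close> the
  trace can therefore vanish only if \<open>D = 0\<close>.\<close>

lemma trace_conj_eq_sum_columns:
  "trace (transpose D ** P ** D) = (\<Sum>i\<in>UNIV. column i D \<bullet> (P *v column i (D :: real^'m^'m)))"
proof -
  have "(transpose D ** P ** D) $ i $ i = column i D \<bullet> (P *v column i D)" for i
    unfolding matrix_mul_assoc[symmetric]
    by (simp add: matrix_matrix_mult_def transpose_def column_def inner_vec_def
        matrix_vector_mult_def)
  then show ?thesis by (simp add: trace_def)
qed

text \<open>For \<open>D = S - T\<close> the trace of \<open>D (S D + D T) = D (S\<^sup>2 - T\<^sup>2) = 0\<close> is a sum of nonnegative terms.\<close>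

lemma positive_definite_sqrt_unique:
  assumes "positive_definite S" "positive_definite T" "S ** S = T ** T"
  shows "S = T"
proof -
  define D where "D = S - T"
  have sym: "transpose D = D"
    using assms by (simp add: D_def transpose_diff positive_definite_def)
  have "S ** D + D ** T = 0"
  proof -
    have "S ** D + D ** T = S ** S - T ** T"
      by (simp add: D_def matrix_matrix_mult_def vec_eq_iff algebra_simps sum_subtractf)
    then show ?thesis using assms(3) by simp
  qed
  then have "trace (D ** (S ** D + D ** T)) = 0"
    by (simp add: trace_def)
  \<comment> \<open>Cyclic invariance puts a factor \<open>D\<close> on either side of
    \<open>T\<close>, so that both traces are sums over columns.\<close>
  moreover have "trace (D ** (D ** T)) = trace (D ** T ** D)"
    by (metis trace_mul_sym)
  ultimately have "trace (transpose D ** S ** D) + trace (transpose D ** T ** D) = 0"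
    by (simp add: matrix_add_ldistrib trace_add matrix_mul_assoc sym)
  moreover have "trace (transpose D ** T ** D) \<ge> 0"
    unfolding trace_conj_eq_sum_columns
    by (intro sum_nonneg positive_definite_nonneg assms)
  ultimately have "(\<Sum>i\<in>UNIV. column i D \<bullet> (S *v column i D)) \<le> 0"
    unfolding trace_conj_eq_sum_columns[symmetric] by linarith
  then have "\<forall>i\<in>UNIV. column i D \<bullet> (S *v column i D) = 0"
    using positive_definite_nonneg[OF assms(1)]
    by (subst sum_nonneg_eq_0_iff[symmetric]) (auto intro: antisym sum_nonneg)
  then have "column i D = 0" for i
    using assms(1) by (metis UNIV_I less_irrefl positive_definite_def)
  then have "D = 0" by (simp add: column_def vec_eq_iff)
  then show ?thesis by (simp add: D_def)
qed

section \<open>Existence of the square root\<close>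

lemma positive_definite_coercive:
  assumes "positive_definite (P :: real^'m^'m)"
  obtains \<mu> where "\<mu> > 0" "\<And>v. v \<bullet> (P *v v) \<ge> \<mu> * (norm v)\<^sup>2"
proof -
  have "continuous_on (sphere 0 1) (\<lambda>v. v \<bullet> (P *v v))"
    by (intro continuous_intros linear_continuous_on matrix_vector_mul_bounded_linear)
  moreover have "sphere (0 :: real^'m) 1 \<noteq> {}" by simp
  ultimately obtain a where a: "norm a = 1" "\<And>v. norm v = 1 \<Longrightarrow> a \<bullet> (P *v a) \<le> v \<bullet> (P *v v)"
    using continuous_attains_inf[of "sphere 0 1" "\<lambda>v. v \<bullet> (P *v v)"] by auto
  \<comment> \<open>The minimum of the form on the compact unit sphere serves as
    \<open>\<mu>\<close>; scaling extends the bound to all vectors.\<close>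
  show thesis
  proof
    have "a \<noteq> 0" using a(1) by auto
    then show "a \<bullet> (P *v a) > 0" using assms by (auto simp: positive_definite_def)
    fix v
    show "v \<bullet> (P *v v) \<ge> a \<bullet> (P *v a) * (norm v)\<^sup>2"
    proof (cases "v = 0")
      case False
      have "a \<bullet> (P *v a) \<le> (v /\<^sub>R norm v) \<bullet> (P *v (v /\<^sub>R norm v))"
        by (rule a(2)) (simp add: False)
      also have "\<dots> = (v \<bullet> (P *v v)) / (norm v)\<^sup>2"
        by (simp add: matrix_vector_mult_scaleR power2_eq_square divide_inverse)
      finally show ?thesis using False by (simp add: field_simps)
    qed simp
  qed
qed

lemma positive_definite_scaled_near_identity:
  assumes "positive_definite (P :: real^'m^'m)"
  obtains t \<beta> where "t > 0" "0 \<le> \<beta>" "\<beta> < 1" "\<And>v. norm (v - t *\<^sub>R (P *v v)) \<le> \<beta> * norm v"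
proof -
  obtain \<mu> where \<mu>: "\<mu> > 0" "\<And>v. v \<bullet> (P *v v) \<ge> \<mu> * (norm v)\<^sup>2"
    using positive_definite_coercive[OF assms] by blast
  obtain K where K: "K > 0" "\<And>v. norm (P *v v) \<le> norm v * K"
    using bounded_linear.pos_bounded[OF matrix_vector_mul_bounded_linear[of P]] by auto
  \<comment> \<open>Expanding the square below gives the factor
    \<open>1 - 2 * t * \<mu> + t^2 * K^2\<close>; this \<open>t\<close> minimizes it, with value
    \<open>1 - \<mu>^2 / K^2\<close>.\<close>
  define t where "t = \<mu> / K\<^sup>2"
  have t: "t > 0" using \<mu> K by (simp add: t_def)
  have est: "(norm (v - t *\<^sub>R (P *v v)))\<^sup>2 \<le> (1 - \<mu>\<^sup>2 / K\<^sup>2) * (norm v)\<^sup>2" for v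
  proof -
    have "(norm (v - t *\<^sub>R (P *v v)))\<^sup>2 =
        (norm v)\<^sup>2 - 2 * t * (v \<bullet> (P *v v)) + t\<^sup>2 * (norm (P *v v))\<^sup>2"
      unfolding power2_norm_eq_inner
      by (simp add: inner_diff_left inner_diff_right inner_commute[of "P *v v" v]
          power2_eq_square algebra_simps)
    also have "\<dots> \<le> (norm v)\<^sup>2 - 2 * t * (\<mu> * (norm v)\<^sup>2) + t\<^sup>2 * (norm v * K)\<^sup>2"
      using t \<mu>(2) K by (intro add_mono diff_mono mult_left_mono power_mono) auto
    also have "\<dots> = (1 - \<mu>\<^sup>2 / K\<^sup>2) * (norm v)\<^sup>2"
      using K by (simp add: t_def field_simps power2_eq_square)
    finally show ?thesis .
  qed
  \<comment> \<open>Any unit vector would do: the estimate there bounds a square by the factor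
    itself.\<close>
  have nonneg: "1 - \<mu>\<^sup>2 / K\<^sup>2 \<ge> 0"
    using order_trans[OF zero_le_power2 est[of "axis undefined 1"]] by simp
  show thesis
  proof
    show "t > 0" by (rule t)
    show "0 \<le> sqrt (1 - \<mu>\<^sup>2 / K\<^sup>2)" using nonneg by simp
    show "sqrt (1 - \<mu>\<^sup>2 / K\<^sup>2) < 1" using \<mu> K by simp
    show "norm (v - t *\<^sub>R (P *v v)) \<le> sqrt (1 - \<mu>\<^sup>2 / K\<^sup>2) * norm v" for v
      using real_sqrt_le_mono[OF est[of v]] by (simp add: real_sqrt_mult)
  qed
qed

text \<open>
  With \<open>B = I - t P\<close> of operator norm below \<open>1\<close>, a fixed point of \<open>X \<mapsto> (B + X\<^sup>2) / 2\<close>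
  satisfies \<open>(I - X)\<^sup>2 = t P\<close>; the map is a contraction on a small ball of self-adjoint
  operators.  Bounded linear functions are used because the norm of the type of matrices is the
  Frobenius norm.
\<close>

lemma sqrt_fixed_point:
  fixes B :: "'a::euclidean_space \<Rightarrow>\<^sub>L 'a"
  assumes "norm B \<le> \<beta>" "\<beta> < 1" and sym: "\<And>u v. u \<bullet> blinfun_apply B v = blinfun_apply B u \<bullet> v"
  obtains X where "norm X \<le> \<beta>" "\<And>u v. u \<bullet> blinfun_apply X v = blinfun_apply X u \<bullet> v"
    "X = (1/2) *\<^sub>R (B + (X o\<^sub>L X))"
proof -
  define Q where "Q = {X :: 'a \<Rightarrow>\<^sub>L 'a. norm X \<le> \<beta> \<and>
    (\<forall>u v. u \<bullet> blinfun_apply X v = blinfun_apply X u \<bullet> v)}"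
  have \<beta>: "0 \<le> \<beta>" using assms(1) norm_ge_zero order_trans by blast
  have "closed Q"
    unfolding Q_def
    by (intro closed_Collect_conj closed_Collect_all closed_Collect_le closed_Collect_eq
        continuous_intros)
  then have "complete Q" by (simp add: complete_eq_closed)
  moreover have "0 \<in> Q" using \<beta> by (simp add: Q_def)
  moreover have "(1/2) *\<^sub>R (B + (X o\<^sub>L X)) \<in> Q" if "X \<in> Q" for X
  proof -
    have X: "norm X \<le> \<beta>" "\<And>u v. u \<bullet> blinfun_apply X v = blinfun_apply X u \<bullet> v"
      using that by (auto simp: Q_def)
    have "norm (X o\<^sub>L X) \<le> norm X * norm X" by (rule norm_blinfun_compose)
    also have "\<dots> \<le> \<beta> * 1" using X(1) assms \<beta> by (intro mult_mono) auto
    finally have "norm (B + (X o\<^sub>L X)) \<le> 2 * \<beta>"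
      using norm_triangle_ineq[of B "X o\<^sub>L X"] assms(1) by linarith
    then show ?thesis
      using X(2) by (simp add: Q_def blinfun.bilinear_simps inner_add_left inner_add_right sym)
  qed
  moreover have "dist ((1/2) *\<^sub>R (B + (X o\<^sub>L X))) ((1/2) *\<^sub>R (B + (Y o\<^sub>L Y))) \<le> \<beta> * dist X Y"
    if "X \<in> Q" "Y \<in> Q" for X Y
  proof -
    have le: "norm X \<le> \<beta>" "norm Y \<le> \<beta>" using that by (auto simp: Q_def)
    \<comment> \<open>This splitting holds without commutativity. Each part has a factor
      \<open>X - Y\<close> and a factor of norm at most \<open>\<beta>\<close>, so after halving the
      Lipschitz constant is \<open>\<beta>\<close>.\<close>
    have "(X o\<^sub>L X) - (Y o\<^sub>L Y) = (X o\<^sub>L (X - Y)) + ((X - Y) o\<^sub>L Y)"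
      by (intro blinfun_eqI) (simp add: blinfun.bilinear_simps)
    also have "norm \<dots> \<le> norm X * norm (X - Y) + norm (X - Y) * norm Y"
      by (intro norm_triangle_mono norm_blinfun_compose)
    also have "\<dots> \<le> \<beta> * norm (X - Y) + norm (X - Y) * \<beta>"
      using le \<beta> by (intro add_mono mult_mono) auto
    finally have "norm ((X o\<^sub>L X) - (Y o\<^sub>L Y)) \<le> 2 * (\<beta> * norm (X - Y))" by simp
    moreover have "(1/2) *\<^sub>R (B + (X o\<^sub>L X)) - (1/2) *\<^sub>R (B + (Y o\<^sub>L Y)) =
        (1/2) *\<^sub>R ((X o\<^sub>L X) - (Y o\<^sub>L Y))"
      by (simp add: scaleR_diff_right scaleR_add_right)
    ultimately show ?thesis by (simp add: dist_norm)
  qed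
  ultimately obtain X where "X \<in> Q" "(1/2) *\<^sub>R (B + (X o\<^sub>L X)) = X"
    using Banach_fix[of Q \<beta> "\<lambda>X. (1/2) *\<^sub>R (B + (X o\<^sub>L X))"] assms(2) \<beta> by blast
  then show thesis by (intro that[of X]) (auto simp: Q_def)
qed

lemma positive_definite_sqrt_exists:
  assumes "positive_definite (P :: real^'m^'m)"
  obtains S where "positive_definite S" "S ** S = P"
proof -
  obtain t \<beta> where t: "t > 0" and \<beta>: "0 \<le> \<beta>" "\<beta> < 1"
    and near: "\<And>v. norm (v - t *\<^sub>R (P *v v)) \<le> \<beta> * norm v"
    using positive_definite_scaled_near_identity[OF assms] by blast
  define B where "B = Blinfun (\<lambda>v. v - t *\<^sub>R (P *v v))"
  have B: "blinfun_apply B v = v - t *\<^sub>R (P *v v)" for v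
    unfolding B_def
    by (subst bounded_linear_Blinfun_apply)
       (auto intro!: bounded_linear_intros matrix_vector_mul_bounded_linear)
  have "norm B \<le> \<beta>"
    by (rule norm_blinfun_bound) (use \<beta> near B in auto)
  moreover have "u \<bullet> blinfun_apply B v = blinfun_apply B u \<bullet> v" for u v
    using inner_matrix_vector[of u P v] assms
    by (simp add: B inner_diff_left inner_diff_right positive_definite_def)
  ultimately obtain X where X: "norm X \<le> \<beta>"
    and symX: "\<And>u v. u \<bullet> blinfun_apply X v = blinfun_apply X u \<bullet> v"
    and fixX: "X = (1/2) *\<^sub>R (B + (X o\<^sub>L X))"
    using sqrt_fixed_point[of B \<beta>] \<beta>(2) by blast
  \<comment> \<open>The fixed point satisfies \<open>(I - X)^2 = t P\<close>, so
    \<open>S = (I - X) / sqrt t\<close> squares to \<open>P\<close>; it is positive because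
    \<open>X\<close> has norm below 1.\<close>
  define s where "s = 1 / sqrt t"
  have s: "s > 0" "s * s * t = 1" using t by (simp_all add: s_def)
  define S where "S = matrix (\<lambda>v. s *\<^sub>R (v - blinfun_apply X v))"
  have lin: "linear (\<lambda>v. s *\<^sub>R (v - blinfun_apply X v))"
    by (intro linearI) (simp_all add: blinfun.bilinear_simps algebra_simps)
  have S: "S *v v = s *\<^sub>R (v - blinfun_apply X v)" for v
    unfolding S_def by (rule matrix_works) (use lin in \<open>simp only: linear_matrix_vector_mul_eq\<close>)
  show thesis
  proof
    have "u \<bullet> (S *v v) = (S *v u) \<bullet> v" for u v
      by (simp add: S inner_diff_left inner_diff_right symX)
    then have "\<forall>v. (transpose S *v u) \<bullet> v = (S *v u) \<bullet> v" for u
      by (simp add: inner_matrix_vector)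
    then have "transpose S = S" unfolding vector_eq_rdot matrix_eq by blast
    moreover have "v \<bullet> (S *v v) > 0" if "v \<noteq> 0" for v
    proof -
      have "v \<bullet> blinfun_apply X v \<le> norm v * (norm X * norm v)"
        by (rule order_trans[OF norm_cauchy_schwarz mult_left_mono[OF norm_blinfun]]) simp
      also have "\<dots> \<le> norm v * (\<beta> * norm v)"
        using X by (intro mult_left_mono mult_right_mono) auto
      also have "\<dots> < v \<bullet> v"
        using that \<beta> by (simp add: power2_norm_eq_inner[symmetric] power2_eq_square)
      finally show ?thesis using s by (simp add: S inner_diff_right)
    qed
    ultimately show "positive_definite S" by (simp add: positive_definite_def)
    have "(S ** S) *v v = P *v v" for v
    proof -
      have "2 *\<^sub>R blinfun_apply X v = 2 *\<^sub>R blinfun_apply ((1/2) *\<^sub>R (B + (X o\<^sub>L X))) v"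
        by (rule arg_cong[OF fixX])
      also have "\<dots> = v - t *\<^sub>R (P *v v) + blinfun_apply X (blinfun_apply X v)"
        by (simp add: blinfun.bilinear_simps B)
      finally have "2 *\<^sub>R blinfun_apply X v =
          v - t *\<^sub>R (P *v v) + blinfun_apply X (blinfun_apply X v)" .
      then have "v - 2 *\<^sub>R blinfun_apply X v + blinfun_apply X (blinfun_apply X v) = t *\<^sub>R (P *v v)"
        by (simp add: algebra_simps)
      moreover have "(S ** S) *v v =
          (s * s) *\<^sub>R (v - 2 *\<^sub>R blinfun_apply X v + blinfun_apply X (blinfun_apply X v))"
      proof -
        have "(S ** S) *v v = S *v (S *v v)" by (simp only: matrix_vector_mul_assoc)
        then show ?thesis
          by (simp add: S blinfun.bilinear_simps scaleR_2 scaleR_diff_right scaleR_add_right)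
      qed
      ultimately show ?thesis using s(2) by simp
    qed
    then show "S ** S = P" by (simp add: matrix_eq)
  qed
qed

text \<open>Existence and uniqueness justify the definite description. For MRNE this makes the
  weighted residual vanish exactly when the residual does.\<close>

lemma positive_definite_matrix_sqrt:
  assumes "positive_definite P"
  shows "positive_definite (matrix_sqrt P)"
proof -
  obtain S where S: "positive_definite S" "S ** S = P"
    using positive_definite_sqrt_exists[OF assms] by blast
  then have "matrix_sqrt P = S"
    unfolding matrix_sqrt_def
    by (intro the_equality) (auto intro: positive_definite_sqrt_unique[of _ S])
  then show ?thesis using S(1) by simp
qed

section \<open>Krylov spaces and convergence\<close>

lemma krylov_contains_solution:
  fixes A :: "real^'n^'m"
  assumes C: "positive_definite C" and r: "r = (A ** transpose A) *v y"
  obtains k z where "z \<in> krylov A C r k" "(A ** transpose A) *v z = r"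
proof -
  define G where "G = A ** transpose A"
  define T where "T = C ** A ** transpose A"
  have T: "T *v v = C *v (G *v v)" for v
    by (simp add: T_def G_def matrix_vector_mul_assoc matrix_mul_assoc)
  have symG: "transpose G = G" by (simp add: G_def matrix_transpose_mul)
  define f where "f i = matrix_power T i *v (C *v r)" for i
  have f_Suc: "f (Suc i) = T *v f i" for i
    by (simp add: f_def matrix_vector_mul_assoc matrix_mul_assoc)
  define W where "W = span (range f)"
  \<comment> \<open>A basis of \<open>W\<close> chosen among the generators is finite and involves
    only finitely many powers, so all of \<open>W\<close> already lies in one Krylov space.\<close>
  obtain E where E: "E \<subseteq> range f" "independent E" "range f \<subseteq> span E"
    using maximal_independent_subset by blast
  then have "finite E" using independent_imp_finite by blast
  then obtain F where F: "finite F" "E = f ` F"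
    using E(1) finite_subset_image by metis
  obtain k where "F \<subseteq> {..<k}" using F(1) finite_nat_iff_bounded by blast
  then have "E \<subseteq> f ` {..<k}" using F by blast
  then have W_sub: "W \<subseteq> krylov A C r k"
    unfolding W_def krylov_def T_def[symmetric] f_def[symmetric]
    by (rule subset_trans[OF span_minimal[OF E(3) subspace_span] span_mono])
  have lin: "linear ((*v) T)" by simp
  \<comment> \<open>The first generator is \<open>C *v r = T *v y\<close>, because \<open>r\<close>
    is in the range of \<open>G\<close>; every later one is an image under \<open>T\<close> by
    construction.\<close>
  have W_range: "W \<subseteq> range ((*v) T)"
    unfolding W_def
  proof (rule span_minimal)
    show "range f \<subseteq> range ((*v) T)"
    proof safe
      fix i
      show "f i \<in> range ((*v) T)"
      proof (cases i)
        case 0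
        then show ?thesis using r by (auto simp: f_def T G_def)
      next
        case (Suc j)
        then show ?thesis by (simp add: f_Suc)
      qed
    qed
    show "subspace (range ((*v) T))"
      using linear_subspace_image[OF lin subspace_UNIV] .
  qed
  \<comment> \<open>Cancelling the outer \<open>C\<close> and pairing with \<open>w\<close> gives
    the form of \<open>C\<close> at \<open>G *v w\<close>, which must then vanish. Hence range and
    kernel of \<open>T\<close> meet only in 0.\<close>
  have kernel: "T *v w = 0" if "T *v (T *v w) = 0" for w
  proof -
    have "G *v (C *v (G *v w)) = 0"
      using that positive_definite_mult_eq_0_iff[OF C] by (simp add: T)
    then have "(G *v w) \<bullet> (C *v (G *v w)) = 0"
      by (metis inner_matrix_vector inner_zero_right symG)
    then have "G *v w = 0" using C by (metis less_irrefl positive_definite_def)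
    then show ?thesis by (simp add: T)
  qed
  have inj: "inj_on ((*v) T) W"
  proof (rule inj_onI)
    fix u v assume uv: "u \<in> W" "v \<in> W" "T *v u = T *v v"
    then have "u - v \<in> W" unfolding W_def by (simp add: span_diff)
    then obtain w where "u - v = T *v w" using W_range by blast
    moreover have "T *v (u - v) = 0" using uv by (simp add: matrix_vector_mult_diff_distrib)
    ultimately show "u = v" by (metis kernel right_minus_eq)
  qed
  have "(*v) T ` W = span ((*v) T ` range f)"
    unfolding W_def using linear_span_image[OF lin] by simp
  also have "\<dots> \<subseteq> W"
    unfolding W_def by (rule span_mono) (auto simp flip: f_Suc)
  finally have "(*v) T ` W \<subseteq> W" .
  \<comment> \<open>An injective linear map of the finite-dimensional \<open>W\<close> into itself
    is onto, so \<open>C *v r\<close> has a preimage in \<open>W\<close>; cancelling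
    \<open>C\<close> makes it a solution.\<close>
  moreover have "dim ((*v) T ` W) = dim W"
    by (rule dim_image_eq) (use lin inj in \<open>simp_all add: W_def span_span\<close>)
  ultimately have "(*v) T ` W = W"
    using lin by (intro subspace_dim_equal linear_subspace_image) (auto simp: W_def)
  moreover have "C *v r \<in> W"
    unfolding W_def by (rule span_base) (auto simp: f_def intro!: image_eqI[of _ _ 0])
  ultimately obtain z where z: "z \<in> W" "T *v z = C *v r" by (metis imageE)
  then have "C *v (G *v z - r) = 0"
    by (simp add: T matrix_vector_mult_diff_distrib)
  then have "G *v z = r" using positive_definite_mult_eq_0_iff[OF C] by auto
  then show thesis using that z(1) W_sub unfolding G_def by blast
qed

section \<open>Normal equations and minimum-norm solutions\<close>

lemma gram_mult_eq_0D:
  assumes "(A ** transpose A) *v d = 0"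
  shows "transpose A *v (d :: real^'m) = 0"
proof -
  have "(transpose A *v d) \<bullet> (transpose A *v d) = d \<bullet> ((A ** transpose A) *v d)"
    using inner_matrix_vector[of d A "transpose A *v d"] by (simp add: matrix_vector_mul_assoc)
  then show ?thesis using assms by simp
qed

text \<open>A preimage of \<open>b\<close> under \<open>A\<close> splits into a part in the range of
  \<open>A^T\<close> and an orthogonal rest \<open>q\<close>. Testing \<open>q\<close> against
  \<open>A^T A q\<close> gives \<open>A q = 0\<close>, so the first part alone is mapped to
  \<open>b\<close>.\<close>

lemma range_gram: "range ((*v) (A ** transpose A)) = range ((*v) (A :: real^'n^'m))"
proof (intro equalityI subsetI)
  fix b assume "b \<in> range ((*v) A)"
  then obtain y where y: "b = A *v y" by blast
  have sub: "subspace (range ((*v) (transpose A)))"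
    by (intro linear_subspace_image) auto
  obtain p q where pq: "p \<in> span (range ((*v) (transpose A)))"
    "\<And>w. w \<in> span (range ((*v) (transpose A))) \<Longrightarrow> orthogonal q w" "y = p + q"
    using orthogonal_subspace_decomp_exists by blast
  obtain u where u: "p = transpose A *v u" using pq(1) sub by (auto simp: span_eq_iff[THEN iffD2])
  have "orthogonal q (transpose A *v (A *v q))" by (intro pq(2) span_base) blast
  then have "(A *v q) \<bullet> (A *v q) = 0"
    by (simp add: orthogonal_def inner_matrix_vector[of q "transpose A"])
  then have "b = (A ** transpose A) *v u"
    by (simp add: y pq(3) u matrix_vector_right_distrib matrix_vector_mul_assoc)
  then show "b \<in> range ((*v) (A ** transpose A))" by blast
qed (auto simp flip: matrix_vector_mul_assoc)

text \<open>Any other solution differs by a kernel vector of \<open>A\<close>, which is orthogonal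
  to the range of \<open>A^T\<close>; Pythagoras then compares the norms.\<close>

lemma min_norm_solution_normal_equations:
  assumes "(A ** transpose A) *v u = b"
  shows "is_min_norm_solution A b (transpose A *v u)"
proof -
  have "norm (transpose A *v u) \<le> norm y" if "A *v y = b" for y
  proof -
    have "A *v (y - transpose A *v u) = 0"
      using that assms by (simp add: matrix_vector_mult_diff_distrib matrix_vector_mul_assoc)
    then have "(y - transpose A *v u) \<bullet> (transpose A *v u) = 0"
      by (simp add: inner_matrix_vector[of _ "transpose A"])
    then have "orthogonal (transpose A *v u) (y - transpose A *v u)"
      by (simp add: orthogonal_def inner_commute)
    then have "(norm y)\<^sup>2 = (norm (transpose A *v u))\<^sup>2 + (norm (y - transpose A *v u))\<^sup>2"
      using norm_add_Pythagorean by fastforce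
    then show ?thesis by (simp add: power2_le_imp_le)
  qed
  then show ?thesis
    using assms
    by (auto simp: is_min_norm_solution_def is_arg_min_linorder matrix_vector_mul_assoc)
qed

text \<open>This replaces both minimization problems by the equation \<open>G *v u = b\<close>,
  since each objective attains 0 on the final affine Krylov space.\<close>

lemma is_arg_min_attains_0:
  fixes g :: "'a \<Rightarrow> real"
  assumes "Q z" "g z = 0" "\<And>v. g v \<ge> 0"
  shows "is_arg_min g Q u \<longleftrightarrow> Q u \<and> g u = 0"
proof
  assume "is_arg_min g Q u"
  then have "Q u" "g u \<le> g z" using assms(1) by (auto simp: is_arg_min_linorder)
  then show "Q u \<and> g u = 0" using assms(2) assms(3)[of u] by simp
next
  assume "Q u \<and> g u = 0"
  then show "is_arg_min g Q u" using assms(3) by (simp add: is_arg_min_linorder)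
qed

lemma determines_min_norm_solution_prec:
  fixes A :: "real^'n^'m"
  assumes C: "positive_definite C" and b: "b \<in> range ((*v) A)"
    and x0: "x0 \<in> range ((*v) (transpose A))"
  shows "determines_min_norm_solution A b (cgne_iterates A C b x0)"
    and "determines_min_norm_solution A b (mrne_iterates A C b x0)"
proof -
  define G where "G = A ** transpose A"
  \<comment> \<open>The minimizer \<open>u\<close> need not be unique when \<open>G\<close> is
    singular, but \<open>G *v u\<close> determines \<open>transpose A *v u\<close>, so the iterate
    is unique.\<close>
  have G_eqD: "transpose A *v u = transpose A *v v" if "G *v u = G *v v" for u v
    using gram_mult_eq_0D[of A "u - v"] that
    by (simp add: G_def matrix_vector_mult_diff_distrib)
  have "b \<in> range ((*v) G)" using b range_gram[of A] by (simp add: G_def)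
  then obtain us where us: "G *v us = b" by blast
  obtain u0 where u0: "transpose A *v u0 = x0" using x0 by auto
  have Ax0: "A *v x0 = G *v u" if "transpose A *v u = x0" for u
    using that by (auto simp: G_def simp flip: matrix_vector_mul_assoc)
  have "b - A *v x0 = G *v (us - u0)"
    using us Ax0[OF u0] by (simp add: matrix_vector_mult_diff_distrib)
  then obtain k z where z: "z \<in> krylov A C (b - A *v x0) k" "G *v z = b - A *v x0"
    using krylov_contains_solution[OF C, of "b - A *v x0" A "us - u0"] unfolding G_def by metis
  \<comment> \<open>One correction \<open>z\<close> serves every admissible initial
    \<open>u\<close>, because \<open>G *v u\<close> depends on \<open>x0\<close> only.\<close>
  have sol: "G *v (u + z) = b" if "transpose A *v u = x0" for u
    using z(2) Ax0[OF that] by (simp add: matrix_vector_right_distrib)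
  have mem: "u + z \<in> (+) u ` krylov A C (b - A *v x0) k" for u using z(1) by blast
  have cg: "is_arg_min (\<lambda>v. norm (transpose A *v (v - w)))
      (\<lambda>v. v \<in> (+) u ` krylov A C (b - A *v x0) k) v \<longleftrightarrow>
      v \<in> (+) u ` krylov A C (b - A *v x0) k \<and> G *v v = b"
    if "transpose A *v u = x0" "G *v w = b" for u v w
  proof (subst is_arg_min_attains_0[of _ "u + z"])
    show "norm (transpose A *v (u + z - w)) = 0"
      using G_eqD[of "u + z" w] sol that by (simp add: matrix_vector_mult_diff_distrib)
    have "transpose A *v (v - w) = 0 \<longleftrightarrow> G *v v = b"
      using G_eqD[of v w] that(2)
      by (auto simp: matrix_vector_mult_diff_distrib G_def simp flip: matrix_vector_mul_assoc)
    then show "(v \<in> (+) u ` krylov A C (b - A *v x0) k \<and> norm (transpose A *v (v - w)) = 0) \<longleftrightarrow>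
        v \<in> (+) u ` krylov A C (b - A *v x0) k \<and> G *v v = b" by simp
  qed (simp_all add: mem)
  \<comment> \<open>The root of \<open>C\<close> has trivial kernel, so a zero of the objective is a
    zero of the residual.\<close>
  have mr: "is_arg_min (\<lambda>v. norm (matrix_sqrt C *v (b - G *v v)))
      (\<lambda>v. v \<in> (+) u ` krylov A C (b - A *v x0) k) v \<longleftrightarrow>
      v \<in> (+) u ` krylov A C (b - A *v x0) k \<and> G *v v = b"
    if "transpose A *v u = x0" for u v
    by (subst is_arg_min_attains_0[of _ "u + z"])
       (auto simp: sol that mem
          positive_definite_mult_eq_0_iff[OF positive_definite_matrix_sqrt[OF C]])
  have "cgne_iterates A C b x0 k = {transpose A *v us}"
  proof (intro equalityI subsetI)
    show "x \<in> {transpose A *v us}" if "x \<in> cgne_iterates A C b x0 k" for x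
    proof -
      obtain u u' w where x: "x = transpose A *v u"
        and u': "transpose A *v u' = x0" and w: "G *v w = b"
        and "is_arg_min (\<lambda>v. norm (transpose A *v (v - w)))
          (\<lambda>v. v \<in> (+) u' ` krylov A C (b - A *v x0) k) u"
        using \<open>x \<in> cgne_iterates A C b x0 k\<close> unfolding cgne_iterates_def G_def[symmetric] by blast
      then have "G *v u = G *v us" by (simp only: cg[OF u' w] us)
      then show ?thesis using G_eqD[of u us] x by simp
    qed
    have "transpose A *v us = transpose A *v (u0 + z)" using G_eqD us sol[OF u0] by metis
    then show "x \<in> cgne_iterates A C b x0 k" if "x \<in> {transpose A *v us}" for x
      using that cg[OF u0 us, of "u0 + z"] mem[of u0] sol[OF u0] us u0 C
      unfolding cgne_iterates_def G_def[symmetric] by blast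
  qed
  then show "determines_min_norm_solution A b (cgne_iterates A C b x0)"
    using min_norm_solution_normal_equations us
    unfolding determines_min_norm_solution_def G_def by blast
  have "mrne_iterates A C b x0 k = {transpose A *v us}"
  proof (intro equalityI subsetI)
    show "x \<in> {transpose A *v us}" if "x \<in> mrne_iterates A C b x0 k" for x
    proof -
      obtain u u' where x: "x = transpose A *v u"
        and u': "transpose A *v u' = x0"
        and "is_arg_min (\<lambda>v. norm (matrix_sqrt C *v (b - G *v v)))
          (\<lambda>v. v \<in> (+) u' ` krylov A C (b - A *v x0) k) u"
        using \<open>x \<in> mrne_iterates A C b x0 k\<close> unfolding mrne_iterates_def G_def[symmetric] by blast
      then have "G *v u = G *v us" by (simp only: mr[OF u'] us)
      then show ?thesis using G_eqD[of u us] x by simp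
    qed
    have "transpose A *v us = transpose A *v (u0 + z)" using G_eqD us sol[OF u0] by metis
    then show "x \<in> mrne_iterates A C b x0 k" if "x \<in> {transpose A *v us}" for x
      using that mr[OF u0, of "u0 + z"] mem[of u0] sol[OF u0] u0 C
      unfolding mrne_iterates_def G_def[symmetric] by blast
  qed
  then show "determines_min_norm_solution A b (mrne_iterates A C b x0)"
    using min_norm_solution_normal_equations us
    unfolding determines_min_norm_solution_def G_def by blast
qed

theorem theorem4p1:
  fixes A :: "real^'n^'m" and M N :: "real^'m^'m" and l :: nat
  assumes "transpose M = M" and "invertible M"
    and "A ** transpose A = M - N"
    and "l \<ge> 1"
    and "odd l \<Longrightarrow> definite M"
    and "even l \<Longrightarrow> definite (M + N)"
  shows "\<forall>b \<in> range ((*v) A). \<forall>x0 \<in> range ((*v) (transpose A)).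
           determines_min_norm_solution A b
             (cgne_iterates A (signed_prec (inner_prec M N l)) b x0) \<and>
           determines_min_norm_solution A b
             (mrne_iterates A (signed_prec (inner_prec M N l)) b x0)"
proof -
  \<comment> \<open>\<open>N\<close> inherits symmetry from \<open>M\<close> and
    \<open>A A^T\<close>.\<close>
  have "N = M - A ** transpose A" using assms(3) by simp
  then have "transpose N = N" by (simp add: transpose_diff matrix_transpose_mul assms(1))
  then have "positive_definite (signed_prec (inner_prec M N l))"
    using assms by (intro positive_definite_signed_prec definite_inner_prec) auto
  then show ?thesis using determines_min_norm_solution_prec by blast
qed

end
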